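(* Let $\varphi$ be an MPNL formula. If there exists a finite fulfilling compass $\varphi$-structure $\mathcal{G}=(\mathbb{P}_{\mathbb{D}},\mathcal{L})$ (over a finite prefix $D$ of $\mathbb{N}$) which features $\varphi$, then there exists a finite fulfilling compass $\varphi$-structure $\mathcal{G}'=(\mathbb{P}_{\mathbb{D}'},\mathcal{L}')$ featuring $\varphi$ such that $|D'|\le\left(\frac{|\varphi|^2}{4}+\frac{|\varphi|}{2}+1\right)^{2^{3|\varphi|}}$.
   Context: $|\varphi|$ is the length of $\varphi$. MPNL formulae: $\varphi ::= len_{<k} \mid p \mid \neg\varphi \mid \varphi\vee\varphi \mid \lozenge_l\varphi \mid \lozenge_r\varphi$ ($p$ atomic, $k\in\mathbb{N}$), interpreted over intervals $[x,y]$, $x\le y$, of a linear order: $len_{<k}$ holds iff $|x-y|<k$; $\lozenge_l\psi$ holds at $[x,y]$ iff $\psi$ holds at some $[z,x]$; $\lozenge_r\psi$ holds at $[x,y]$ iff $\psi$ holds at some $[y,z]$. $Cl(\varphi)$: subformulae of $\varphi$ and their negations (identifying $\neg\neg\alpha$ with $\alpha$, $\neg\lozenge_r\alpha$ with $\Box_r\neg\alpha$, etc.). A $\varphi$-atom is a non-empty $F\subseteq Cl(\varphi)$ with: $\alpha\in F$ iff $\neg\alpha\notin F$; $\alpha\vee\beta\in F$ iff $\alpha\in F$ or $\beta\in F$ (for $\alpha\vee\beta\in Cl(\varphi)$); for $k<k'$, $len_{<k}\in F$ implies $len_{<k'}\in F$ (when both in $Cl(\varphi)$). $Obs_r(F)=\{\psi\in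 F:\lozenge_r\psi\in Cl(\varphi)\}$, $Obs_l(F)=\{\psi\in F:\lozenge_l\psi\in Cl(\varphi)\}$, $Req_r(F)=\{\psi:\lozenge_r\psi\in F\}$, $Req_l(F)=\{\psi:\lozenge_l\psi\in F\}$; $F\,R\,G$ iff $Obs_r(G)\subseteq Req_r(F)$ and $Obs_l(F)\subseteq Req_l(G)$. A compass $\varphi$-structure over $D$ is $(\mathbb{P}_{\mathbb{D}},\mathcal{L})$ with $\mathbb{P}_{\mathbb{D}}=\{(x,y)\in D^2:x\le y\}$ and $\mathcal{L}$ assigning atoms to points such that: if $y=x'$ then $\mathcal{L}(x,y)\,R\,\mathcal{L}(x',y')$; and $len_{<k}\in\mathcal{L}(x,y)$ implies $y-x<k$. It features $\psi$ if $\psi\in\mathcal{L}(x,y)$ for some point; it is fulfilling if for each point $(x,y)$, each $\psi\in Req_r(\mathcal{L}(x,y))$ occurs in some $\mathcal{L}(y,y')$ and each $\psi\in Req_l(\mathcal{L}(x,y))$ occurs in some $\mathcal{L}(x',x)$. *)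

theory Defs
  imports Complex_Main "HOL-Library.Log_Nat"
begin

datatype 'p mpnl =
    Len nat
  | Prop 'p
  | Neg "'p mpnl"
  | Or "'p mpnl" "'p mpnl"
  | DiaL "'p mpnl"
  | DiaR "'p mpnl"

text \<open>
  The length is the number of symbols. The constant in \<open>Len k\<close> is written in binary;
  the maximum accounts for \<open>k = 0\<close>, whose numeral has one digit although
  \<open>floorlog 2 0 = 0\<close>.
\<close>

fun flength :: "'p mpnl \<Rightarrow> nat" where
  "flength (Len k) = 1 + max 1 (floorlog 2 k)"
| "flength (Prop p) = 1"
| "flength (Neg \<alpha>) = 1 + flength \<alpha>"
| "flength (Or \<alpha> \<beta>) = 1 + flength \<alpha> + flength \<beta>"
| "flength (DiaL \<alpha>) = 1 + flength \<alpha>"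
| "flength (DiaR \<alpha>) = 1 + flength \<alpha>"

text \<open>
  Formulae are identified modulo \<open>\<not>\<not>\<alpha> = \<alpha>\<close>. Every class is represented by its unique member
  without double negations, computed by \<open>canon\<close>; \<open>neg\<close> is the negation on representatives.
  Boxes are not primitive, so the identification of \<open>\<not>\<diamond>\<alpha>\<close> with \<open>\<box>\<not>\<alpha>\<close> is built in.
\<close>

fun neg :: "'p mpnl \<Rightarrow> 'p mpnl" where
  "neg (Neg \<alpha>) = \<alpha>"
| "neg \<alpha> = Neg \<alpha>"

fun canon :: "'p mpnl \<Rightarrow> 'p mpnl" where
  "canon (Len k) = Len k"
| "canon (Prop p) = Prop p"
| "canon (Neg \<alpha>) = neg (canon \<alpha>)"
| "canon (Or \<alpha> \<beta>) = Or (canon \<alpha>) (canon \<beta>)"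
| "canon (DiaL \<alpha>) = DiaL (canon \<alpha>)"
| "canon (DiaR \<alpha>) = DiaR (canon \<alpha>)"

fun subformulae :: "'p mpnl \<Rightarrow> 'p mpnl set" where
  "subformulae (Len k) = {Len k}"
| "subformulae (Prop p) = {Prop p}"
| "subformulae (Neg \<alpha>) = insert (Neg \<alpha>) (subformulae \<alpha>)"
| "subformulae (Or \<alpha> \<beta>) = insert (Or \<alpha> \<beta>) (subformulae \<alpha> \<union> subformulae \<beta>)"
| "subformulae (DiaL \<alpha>) = insert (DiaL \<alpha>) (subformulae \<alpha>)"
| "subformulae (DiaR \<alpha>) = insert (DiaR \<alpha>) (subformulae \<alpha>)"

definition Cl :: "'p mpnl \<Rightarrow> 'p mpnl set" where
  "Cl \<phi> = subformulae (canon \<phi>) \<union> neg ` subformulae (canon \<phi>)"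

definition is_atom :: "'p mpnl \<Rightarrow> 'p mpnl set \<Rightarrow> bool" where
  "is_atom \<phi> F \<longleftrightarrow>
     F \<noteq> {} \<and> F \<subseteq> Cl \<phi> \<and>
     (\<forall>\<alpha>\<in>Cl \<phi>. \<alpha> \<in> F \<longleftrightarrow> neg \<alpha> \<notin> F) \<and>
     (\<forall>\<alpha> \<beta>. Or \<alpha> \<beta> \<in> Cl \<phi> \<longrightarrow> (Or \<alpha> \<beta> \<in> F \<longleftrightarrow> \<alpha> \<in> F \<or> \<beta> \<in> F)) \<and>
     (\<forall>k k'. k < k' \<and> Len k \<in> Cl \<phi> \<and> Len k' \<in> Cl \<phi> \<longrightarrow> Len k \<in> F \<longrightarrow> Len k' \<in> F)"

definition Obs_r :: "'p mpnl \<Rightarrow> 'p mpnl set \<Rightarrow> 'p mpnl set" where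
  "Obs_r \<phi> F = {\<psi> \<in> F. DiaR \<psi> \<in> Cl \<phi>}"

definition Obs_l :: "'p mpnl \<Rightarrow> 'p mpnl set \<Rightarrow> 'p mpnl set" where
  "Obs_l \<phi> F = {\<psi> \<in> F. DiaL \<psi> \<in> Cl \<phi>}"

definition Req_r :: "'p mpnl set \<Rightarrow> 'p mpnl set" where
  "Req_r F = {\<psi>. DiaR \<psi> \<in> F}"

definition Req_l :: "'p mpnl set \<Rightarrow> 'p mpnl set" where
  "Req_l F = {\<psi>. DiaL \<psi> \<in> F}"

definition R :: "'p mpnl \<Rightarrow> 'p mpnl set \<Rightarrow> 'p mpnl set \<Rightarrow> bool" where
  "R \<phi> F G \<longleftrightarrow> Obs_r \<phi> G \<subseteq> Req_r F \<and> Obs_l \<phi> F \<subseteq> Req_l G"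

definition finite_prefix :: "nat set \<Rightarrow> bool" where
  "finite_prefix D \<longleftrightarrow> (\<exists>N. D = {..<N})"

definition points :: "nat set \<Rightarrow> (nat \<times> nat) set" where
  "points D = {(x, y). x \<in> D \<and> y \<in> D \<and> x \<le> y}"

definition compass_structure ::
    "'p mpnl \<Rightarrow> nat set \<Rightarrow> (nat \<times> nat \<Rightarrow> 'p mpnl set) \<Rightarrow> bool" where
  "compass_structure \<phi> D \<L> \<longleftrightarrow>
     (\<forall>P\<in>points D. is_atom \<phi> (\<L> P)) \<and>
     (\<forall>x y x' y'. (x, y) \<in> points D \<and> (x', y') \<in> points D \<and> y = x'
        \<longrightarrow> R \<phi> (\<L> (x, y)) (\<L> (x', y'))) \<and>
     (\<forall>x y k. (x, y) \<in> points D \<and> Len k \<in> \<L> (x, y) \<longrightarrow> y - x < k)"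

definition features :: "nat set \<Rightarrow> (nat \<times> nat \<Rightarrow> 'p mpnl set) \<Rightarrow> 'p mpnl \<Rightarrow> bool" where
  "features D \<L> \<psi> \<longleftrightarrow> (\<exists>P\<in>points D. canon \<psi> \<in> \<L> P)"

definition fulfilling :: "nat set \<Rightarrow> (nat \<times> nat \<Rightarrow> 'p mpnl set) \<Rightarrow> bool" where
  "fulfilling D \<L> \<longleftrightarrow>
     (\<forall>x y. (x, y) \<in> points D \<longrightarrow>
        (\<forall>\<psi>\<in>Req_r (\<L> (x, y)). \<exists>y'. (y, y') \<in> points D \<and> \<psi> \<in> \<L> (y, y')) \<and>
        (\<forall>\<psi>\<in>Req_l (\<L> (x, y)). \<exists>x'. (x', x) \<in> points D \<and> \<psi> \<in> \<L> (x', x)))"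

end

theory Submission
  imports Defs "HOL-Library.FuncSet"
begin

text \<open>
  In a fulfilling structure the requests of a point \<open>(x, y)\<close> to the right are exactly what is observed
  in the intervals starting at \<open>y\<close>, and dually to the left, so they depend on one coordinate only.
  Moreover \<open>Len k\<close> bounds lengths from above only, so shortening intervals never hurts.

  Describe a column \<open>x\<close> at a row \<open>y \<ge> x\<close> by its key: the distance \<open>y - x\<close> truncated at the largest
  constant, the requests of \<open>x\<close>, and the part of its right requests already met up to row \<open>y\<close>.
  If two rows \<open>y1 < y2\<close> have the same number of columns of each key, up to a threshold quadratic in
  the length of the formula, then the rows in between can be cut out: above the cut, the surviving
  columns inherit the labels of columns with the same key at \<open>y2\<close>. The threshold leaves enough freedom
  to serve all pending right requests of the columns and all left requests of the later rows.
  Hence a minimal structure has no more rows than there are truncated counting functions.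
\<close>

section \<open>Reassigning columns\<close>

lemma ex_covering_map:
  assumes "finite E" "finite W" "card W \<le> card E" "W \<subseteq> B" "b \<in> B"
  shows "\<exists>h. h ` E \<subseteq> B \<and> W \<subseteq> h ` E"
proof -
  obtain j where j: "j ` W \<subseteq> E" "inj_on j W"
    using card_le_inj[OF assms(2,1,3)] by blast
  define h where "h x = (if x \<in> j ` W then inv_into W j x else b)" for x
  have "h (j w) = w" if "w \<in> W" for w
    using that j by (simp add: h_def)
  then have "W \<subseteq> h ` E"
    using j(1) by (metis image_subset_iff rev_image_eqI subsetI)
  moreover have "h x \<in> B" for x
    using assms(4,5) inv_into_into[of x j W] by (auto simp: h_def)
  ultimately show ?thesis by blast
qed

text \<open>
  \<open>W y\<close> are the columns needed by row \<open>y\<close>, and \<open>C b\<close> the rows needed by column \<open>b\<close>.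
  For large \<open>A\<close>, one column \<open>b0\<close> is copied sufficiently often: outside of the few rows
  in \<open>C b0\<close> the copies are free to play any roles, and for the rows in \<open>C b0\<close> all needed columns
  are given fixed representatives.
\<close>

lemma ex_column_reassignment:
  fixes C :: "'b \<Rightarrow> 'y set" and W :: "'y \<Rightarrow> 'b set" and A :: "'a set"
  assumes A: "finite A" and B: "finite B"
    and cards: "min ((r + 1) * l) (card A) = min ((r + 1) * l) (card B)" and l: "l > 0"
    and C: "\<And>b. b \<in> B \<Longrightarrow> finite (C b) \<and> card (C b) \<le> r"
    and W: "\<And>y. W y \<subseteq> B" "\<And>y. card (W y) \<le> l"
  shows "\<exists>g. (\<forall>y. \<forall>x\<in>A. g y x \<in> B) \<and> (\<forall>y. \<forall>v\<in>W y. \<exists>x\<in>A. g y x = v) \<and>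
             (\<forall>x\<in>A. \<exists>b\<in>B. \<forall>y\<in>C b. g y x = b)"
proof (cases "card A = card B")
  case True
  \<comment> \<open>One bijection used in every row meets both kinds of demand. The map
    \<open>g\<close> has to depend on the row only when the cardinalities differ.\<close>
  then obtain f where f: "bij_betw f A B"
    using A B finite_same_card_bij by blast
  have "\<forall>v\<in>W y. \<exists>x\<in>A. f x = v" for y
    using W(1)[of y] f by (auto simp: bij_betw_def)
  moreover have "\<forall>x\<in>A. f x \<in> B"
    using f by (auto simp: bij_betw_def)
  ultimately show ?thesis by (intro exI[of _ "\<lambda>_. f"]) blast
next
  case False
  \<comment> \<open>Of the \<open>(r + 1) * l\<close> elements, at most \<open>r * l\<close> become
    fixed representatives, so at least \<open>l\<close> remain as copies of
    \<open>b0\<close>.\<close>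
  then have large: "(r + 1) * l \<le> card A" "(r + 1) * l \<le> card B"
    using cards by linarith+
  then have "B \<noteq> {}" using l by auto
  then obtain b0 where b0: "b0 \<in> B" by blast
  have finW: "finite (W y)" for y using W(1) B finite_subset by blast
  \<comment> \<open>The columns other than \<open>b0\<close> demanded in some row where
    \<open>b0\<close> itself must stay visible: at most \<open>r\<close> rows with at most
    \<open>l\<close> columns each.\<close>
  define B' where "B' = (\<Union>y\<in>C b0. W y) - {b0}"
  have "card B' \<le> card (\<Union>y\<in>C b0. W y)"
    unfolding B'_def using C[OF b0] finW by (intro card_mono) auto
  also have "\<dots> \<le> (\<Sum>y\<in>C b0. card (W y))"
    using C[OF b0] by (intro card_UN_le) auto
  also have "\<dots> \<le> card (C b0) * l"
    using W(2) sum_bounded_above[of "C b0" "\<lambda>y. card (W y)" l] by simp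
  also have "\<dots> \<le> r * l" using C[OF b0] by simp
  finally have cardB': "card B' \<le> r * l" .
  have "card B' \<le> card A" using cardB' large by simp
  then obtain A' where A': "A' \<subseteq> A" "card A' = card B'"
    by (meson obtain_subset_with_card_n)
  have B': "B' \<subseteq> B" using W(1) by (auto simp: B'_def)
  obtain f where f: "bij_betw f A' B'"
    using A' B' A B finite_same_card_bij finite_subset by metis
  define E where "E = A - A'"
  have finE: "finite E" using A by (simp add: E_def)
  have "card E = card A - card A'"
    unfolding E_def using A' A by (meson card_Diff_subset finite_subset)
  then have cardE: "l \<le> card E" using large A' cardB' by simp
  then have "E \<noteq> {}" using l by auto
  then obtain e0 where e0: "e0 \<in> E" by blast
  have "\<exists>h. h ` E \<subseteq> B \<and> W y \<subseteq> h ` E" for y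
    using ex_covering_map[OF finE finW _ W(1) b0] W(2) cardE le_trans by blast
  then obtain h where h: "\<And>y. h y ` E \<subseteq> B" "\<And>y. W y \<subseteq> h y ` E" by metis
  \<comment> \<open>An element of \<open>A'\<close> has the value \<open>f x\<close> in all rows and
    so serves column \<open>f x\<close>; a copy in \<open>E\<close> shows \<open>b0\<close>
    throughout \<open>C b0\<close> and so serves \<open>b0\<close>. In the rows of
    \<open>C b0\<close> the demand \<open>W y\<close> is covered by \<open>A'\<close> and one copy,
    in all other rows by the copies.\<close>
  define g where "g y x = (if x \<in> A' then f x else if y \<in> C b0 then b0 else h y x)" for y x
  have gf: "g y x = f x" if "x \<in> A'" for x y using that by (simp add: g_def)
  have gb: "g y x = b0" if "x \<in> E" "y \<in> C b0" for x y using that by (simp add: g_def E_def)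
  have gh: "g y x = h y x" if "x \<in> E" "y \<notin> C b0" for x y using that by (simp add: g_def E_def)
  have AE: "A = A' \<union> E" using A' by (auto simp: E_def)
  have fB: "f x \<in> B" if "x \<in> A'" for x using that f B' by (auto simp: bij_betw_def)
  have "g y x \<in> B" if "x \<in> A" for x y
    using that AE fB gf gb gh h(1) b0 by (metis UnE image_subset_iff)
  moreover have "\<exists>x\<in>A. g y x = v" if v: "v \<in> W y" for y v
  proof (cases "y \<in> C b0")
    case True
    show ?thesis
    proof (cases "v = b0")
      case True
      then show ?thesis using gb e0 \<open>y \<in> C b0\<close> AE by blast
    next
      case False
      then have "v \<in> B'" using v True by (auto simp: B'_def)
      then obtain x where "x \<in> A'" "f x = v" using f by (auto simp: bij_betw_def)
      then show ?thesis using gf AE by blast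
    qed
  next
    case False
    obtain x where "x \<in> E" "h y x = v" using h(2) v by blast
    then show ?thesis using gh[OF _ False] AE by blast
  qed
  moreover have "\<exists>b\<in>B. \<forall>y\<in>C b. g y x = b" if "x \<in> A" for x
    using that AE fB gf gb b0 by blast
  ultimately show ?thesis by blast
qed

section \<open>Diamonds and constants in the closure\<close>

lemma flength_neg: "flength (neg \<alpha>) \<le> 1 + flength \<alpha>"
  by (cases \<alpha>) auto

lemma flength_canon: "flength (canon \<alpha>) \<le> flength \<alpha>"
  by (induction \<alpha>) (use flength_neg le_trans in \<open>fastforce+\<close>)

lemma finite_subformulae: "finite (subformulae \<alpha>)"
  by (induction \<alpha>) auto

lemma subformulae_refl: "\<alpha> \<in> subformulae \<alpha>"
  by (cases \<alpha>) auto

lemma subformulae_NegD: "Neg \<beta> \<in> subformulae \<alpha> \<Longrightarrow> \<beta> \<in> subformulae \<alpha>"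
  by (induction \<alpha>) (auto simp: subformulae_refl)

text \<open>\<open>neg\<close> adds a negation or strips one, and the stripped formula is again a
  subformula. So closing under \<open>neg\<close> adds nothing but negations.\<close>

lemma in_Cl_iff:
  assumes "\<And>\<beta>. \<alpha> \<noteq> Neg \<beta>"
  shows "\<alpha> \<in> Cl \<phi> \<longleftrightarrow> \<alpha> \<in> subformulae (canon \<phi>)"
proof -
  have "\<alpha> \<in> subformulae (canon \<phi>)" if "\<beta> \<in> subformulae (canon \<phi>)" "\<alpha> = neg \<beta>" for \<beta>
    using that assms by (cases \<beta>) (auto dest: subformulae_NegD)
  then show ?thesis by (auto simp: Cl_def)
qed

definition dia_args_l :: "'p mpnl \<Rightarrow> 'p mpnl set" where
  "dia_args_l \<phi> = {\<psi>. DiaL \<psi> \<in> Cl \<phi>}"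

definition dia_args_r :: "'p mpnl \<Rightarrow> 'p mpnl set" where
  "dia_args_r \<phi> = {\<psi>. DiaR \<psi> \<in> Cl \<phi>}"

lemma finite_dia_subformulae:
  "finite {\<psi>. DiaL \<psi> \<in> subformulae \<alpha>}" "finite {\<psi>. DiaR \<psi> \<in> subformulae \<alpha>}"
  using finite_vimageI[OF finite_subformulae, of DiaL \<alpha>]
    finite_vimageI[OF finite_subformulae, of DiaR \<alpha>]
  by (simp_all add: vimage_def inj_on_def)

text \<open>Each argument is charged to a diamond symbol standing in front of it. The inequality is
  strict because every formula has a leaf, which is no diamond.\<close>

lemma card_dia_subformulae:
  "card {\<psi>. DiaL \<psi> \<in> subformulae \<alpha>} + card {\<psi>. DiaR \<psi> \<in> subformulae \<alpha>} < flength \<alpha>"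
proof (induction \<alpha>)
  case (Or \<alpha> \<beta>)
  have "card {\<psi>. DiaL \<psi> \<in> subformulae (Or \<alpha> \<beta>)}
      \<le> card {\<psi>. DiaL \<psi> \<in> subformulae \<alpha>} + card {\<psi>. DiaL \<psi> \<in> subformulae \<beta>}"
    using card_Un_le[of "{\<psi>. DiaL \<psi> \<in> subformulae \<alpha>}" "{\<psi>. DiaL \<psi> \<in> subformulae \<beta>}"]
    by (simp add: Collect_disj_eq)
  moreover have "card {\<psi>. DiaR \<psi> \<in> subformulae (Or \<alpha> \<beta>)}
      \<le> card {\<psi>. DiaR \<psi> \<in> subformulae \<alpha>} + card {\<psi>. DiaR \<psi> \<in> subformulae \<beta>}"
    using card_Un_le[of "{\<psi>. DiaR \<psi> \<in> subformulae \<alpha>}" "{\<psi>. DiaR \<psi> \<in> subformulae \<beta>}"]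
    by (simp add: Collect_disj_eq)
  ultimately show ?case using Or by simp
next
  case (DiaL \<alpha>)
  have "{\<psi>. DiaL \<psi> \<in> subformulae (DiaL \<alpha>)} = insert \<alpha> {\<psi>. DiaL \<psi> \<in> subformulae \<alpha>}" by auto
  then show ?case using DiaL
    by (simp add: card_insert_if finite_dia_subformulae)
next
  case (DiaR \<alpha>)
  have "{\<psi>. DiaR \<psi> \<in> subformulae (DiaR \<alpha>)} = insert \<alpha> {\<psi>. DiaR \<psi> \<in> subformulae \<alpha>}" by auto
  then show ?case using DiaR
    by (simp add: card_insert_if finite_dia_subformulae)
qed auto

lemma dia_args_eq_subformulae:
  "dia_args_l \<phi> = {\<psi>. DiaL \<psi> \<in> subformulae (canon \<phi>)}"
  "dia_args_r \<phi> = {\<psi>. DiaR \<psi> \<in> subformulae (canon \<phi>)}"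
  by (simp_all add: dia_args_l_def dia_args_r_def in_Cl_iff)

lemma finite_dia_args: "finite (dia_args_l \<phi>)" "finite (dia_args_r \<phi>)"
  by (simp_all add: dia_args_eq_subformulae finite_dia_subformulae)

lemma card_dia_args: "card (dia_args_l \<phi>) + card (dia_args_r \<phi>) < flength \<phi>"
  using card_dia_subformulae[of "canon \<phi>"] flength_canon[of \<phi>]
  by (simp add: dia_args_eq_subformulae)

text \<open>A binary numeral with d digits denotes a number below 2^d. At least one symbol of the
  formula is not a digit, hence the exponent.\<close>

lemma Len_subformula_less: "Len k \<in> subformulae \<alpha> \<Longrightarrow> k < 2 ^ (flength \<alpha> - 1)"
proof (induction \<alpha>)
  case (Len j)
  have "k < 2 ^ floorlog 2 k" 
    using floorlog_bounds[of k 2] by (cases "k = 0") auto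
  also have "(2::nat) ^ floorlog 2 k \<le> 2 ^ max 1 (floorlog 2 k)" by (intro power_increasing) auto
  finally show ?case using Len by simp
next
  case (Or \<alpha> \<beta>)
  have "(2::nat) ^ (flength \<alpha> - 1) \<le> 2 ^ (flength (Or \<alpha> \<beta>) - 1)"
    "(2::nat) ^ (flength \<beta> - 1) \<le> 2 ^ (flength (Or \<alpha> \<beta>) - 1)"
    by (intro power_increasing; simp)+
  then show ?case using Or less_le_trans by fastforce
next
  case (Neg \<alpha>)
  have "(2::nat) ^ (flength \<alpha> - 1) \<le> 2 ^ (flength (Neg \<alpha>) - 1)" by (intro power_increasing) auto
  then show ?case using Neg less_le_trans by fastforce
next
  case (DiaL \<alpha>)
  have "(2::nat) ^ (flength \<alpha> - 1) \<le> 2 ^ (flength (DiaL \<alpha>) - 1)" by (intro power_increasing) auto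
  then show ?case using DiaL less_le_trans by fastforce
next
  case (DiaR \<alpha>)
  have "(2::nat) ^ (flength \<alpha> - 1) \<le> 2 ^ (flength (DiaR \<alpha>) - 1)" by (intro power_increasing) auto
  then show ?case using DiaR less_le_trans by fastforce
qed auto

lemma Len_in_Cl_less: "Len k \<in> Cl \<phi> \<Longrightarrow> k < 2 ^ (flength \<phi> - 1)"
proof -
  assume "Len k \<in> Cl \<phi>"
  then have "k < 2 ^ (flength (canon \<phi>) - 1)" by (intro Len_subformula_less) (simp add: in_Cl_iff)
  also have "\<dots> \<le> 2 ^ (flength \<phi> - 1)" 
    using flength_canon[of \<phi>] by (intro power_increasing) auto
  finally show ?thesis .
qed

section \<open>Fulfilling structures through observations\<close>

definition observed_r :: "'p mpnl \<Rightarrow> nat \<Rightarrow> (nat \<times> nat \<Rightarrow> 'p mpnl set) \<Rightarrow> nat \<Rightarrow> 'p mpnl set" where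
  "observed_r \<phi> N \<L> y = {\<psi> \<in> dia_args_r \<phi>. \<exists>y'\<ge>y. y' < N \<and> \<psi> \<in> \<L> (y, y')}"

definition observed_l :: "'p mpnl \<Rightarrow> (nat \<times> nat \<Rightarrow> 'p mpnl set) \<Rightarrow> nat \<Rightarrow> 'p mpnl set" where
  "observed_l \<phi> \<L> x = {\<psi> \<in> dia_args_l \<phi>. \<exists>x'\<le>x. \<psi> \<in> \<L> (x', x)}"

text \<open>Fulfilment includes the requests in the observations, and \<open>R\<close> gives the
  reverse inclusions. As equations they become a condition on single points, with the right side
  depending on one coordinate only.\<close>

definition exact_structure :: "'p mpnl \<Rightarrow> nat \<Rightarrow> (nat \<times> nat \<Rightarrow> 'p mpnl set) \<Rightarrow> bool" where
  "exact_structure \<phi> N \<L> \<longleftrightarrow> (\<forall>x y. x \<le> y \<and> y < N \<longrightarrow>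
     is_atom \<phi> (\<L> (x, y)) \<and>
     (\<forall>k. Len k \<in> \<L> (x, y) \<longrightarrow> y - x < k) \<and>
     Req_r (\<L> (x, y)) = observed_r \<phi> N \<L> y \<and>
     Req_l (\<L> (x, y)) = observed_l \<phi> \<L> x)"

lemma exact_structureD:
  assumes "exact_structure \<phi> N \<L>" "x \<le> y" "y < N"
  shows "is_atom \<phi> (\<L> (x, y))" "\<And>k. Len k \<in> \<L> (x, y) \<Longrightarrow> y - x < k"
    "Req_r (\<L> (x, y)) = observed_r \<phi> N \<L> y" "Req_l (\<L> (x, y)) = observed_l \<phi> \<L> x"
  using assms by (auto simp: exact_structure_def)

lemma in_points_lessThan: "(x, y) \<in> points {..<N} \<longleftrightarrow> x \<le> y \<and> y < N"
  by (auto simp: points_def)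

lemma exact_structure_if_fulfilling:
  assumes c: "compass_structure \<phi> {..<N} \<L>" and f: "fulfilling {..<N} \<L>"
  shows "exact_structure \<phi> N \<L>"
  unfolding exact_structure_def
proof (intro allI impI conjI)
  fix x y assume xy: "x \<le> y \<and> y < N"
  have R: "R \<phi> (\<L> (a, b)) (\<L> (b, d))" if "a \<le> b" "b \<le> d" "d < N" for a b d
    using c that le_less_trans[of b d N] unfolding compass_structure_def in_points_lessThan by auto
  show atom: "is_atom \<phi> (\<L> (x, y))"
    using c xy unfolding compass_structure_def by (metis in_points_lessThan)
  show "y - x < k" if "Len k \<in> \<L> (x, y)" for k
    using c xy that unfolding compass_structure_def in_points_lessThan by blast
  have Cl: "\<L> (x, y) \<subseteq> Cl \<phi>" using atom by (simp add: is_atom_def)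
  show "Req_r (\<L> (x, y)) = observed_r \<phi> N \<L> y"
  proof (intro set_eqI iffI)
    fix \<psi> assume \<psi>: "\<psi> \<in> Req_r (\<L> (x, y))"
    then have "\<exists>y'\<ge>y. y' < N \<and> \<psi> \<in> \<L> (y, y')"
      using f xy unfolding fulfilling_def in_points_lessThan by blast
    then show "\<psi> \<in> observed_r \<phi> N \<L> y"
      using \<psi> Cl by (auto simp: observed_r_def dia_args_r_def Req_r_def)
  next
    fix \<psi> assume "\<psi> \<in> observed_r \<phi> N \<L> y"
    then obtain y' where y': "y \<le> y'" "y' < N" "\<psi> \<in> Obs_r \<phi> (\<L> (y, y'))"
      by (auto simp: observed_r_def dia_args_r_def Obs_r_def)
    then show "\<psi> \<in> Req_r (\<L> (x, y))" using R[of x y y'] xy by (auto simp: R_def)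
  qed
  show "Req_l (\<L> (x, y)) = observed_l \<phi> \<L> x"
  proof (intro set_eqI iffI)
    fix \<psi> assume \<psi>: "\<psi> \<in> Req_l (\<L> (x, y))"
    then have "\<exists>x'\<le>x. \<psi> \<in> \<L> (x', x)"
      using f xy unfolding fulfilling_def in_points_lessThan by blast
    then show "\<psi> \<in> observed_l \<phi> \<L> x"
      using \<psi> Cl by (auto simp: observed_l_def dia_args_l_def Req_l_def)
  next
    fix \<psi> assume "\<psi> \<in> observed_l \<phi> \<L> x"
    then obtain x' where x': "x' \<le> x" "\<psi> \<in> Obs_l \<phi> (\<L> (x', x))"
      by (auto simp: observed_l_def dia_args_l_def Obs_l_def)
    then show "\<psi> \<in> Req_l (\<L> (x, y))" using R[of x' x y] xy by (auto simp: R_def)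
  qed
qed

lemma fulfilling_if_exact_structure:
  assumes e: "exact_structure \<phi> N \<L>"
  shows "compass_structure \<phi> {..<N} \<L>" "fulfilling {..<N} \<L>"
proof -
  have R: "R \<phi> (\<L> (x, y)) (\<L> (y, z))" if "x \<le> y" "y \<le> z" "z < N" for x y z
    using that exact_structureD(3)[OF e, of x y] exact_structureD(4)[OF e, of y z]
    by (auto simp: R_def Obs_r_def Obs_l_def observed_r_def observed_l_def
        dia_args_l_def dia_args_r_def)
  show "compass_structure \<phi> {..<N} \<L>"
    unfolding compass_structure_def
    using exact_structureD(1,2)[OF e] R by (auto simp: in_points_lessThan)
  show "fulfilling {..<N} \<L>"
    unfolding fulfilling_def in_points_lessThan
    using exact_structureD(3,4)[OF e] le_less_trans by (auto simp: observed_r_def observed_l_def)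
qed

section \<open>Contraction\<close>

definition seen_r :: "'p mpnl \<Rightarrow> (nat \<times> nat \<Rightarrow> 'p mpnl set) \<Rightarrow> nat \<Rightarrow> nat \<Rightarrow> 'p mpnl set" where
  "seen_r \<phi> \<L> y x = {\<psi> \<in> dia_args_r \<phi>. \<exists>y'\<ge>x. y' \<le> y \<and> \<psi> \<in> \<L> (x, y')}"

text \<open>The cap on the distance is an upper bound for every \<open>k\<close> with
  \<open>Len k\<close> in the closure; at that distance no such \<open>Len k\<close> can hold any
  more.\<close>

definition column_key ::
    "'p mpnl \<Rightarrow> nat \<Rightarrow> (nat \<times> nat \<Rightarrow> 'p mpnl set) \<Rightarrow> nat \<Rightarrow> nat \<Rightarrow>
       nat \<times> 'p mpnl set \<times> 'p mpnl set \<times> 'p mpnl set" where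
  "column_key \<phi> N \<L> y x =
     (min (2 ^ (flength \<phi> - 1) - 1) (y - x), observed_l \<phi> \<L> x, observed_r \<phi> N \<L> x, seen_r \<phi> \<L> y x)"

definition key_space ::
    "'p mpnl \<Rightarrow> (nat \<times> 'p mpnl set \<times> 'p mpnl set \<times> 'p mpnl set) set" where
  "key_space \<phi> = {..2 ^ (flength \<phi> - 1) - 1} \<times> Pow (dia_args_l \<phi>) \<times> Pow (dia_args_r \<phi>) \<times>
     Pow (dia_args_r \<phi>)"

lemma column_key_in_key_space: "column_key \<phi> N \<L> y x \<in> key_space \<phi>"
  by (auto simp: column_key_def key_space_def observed_l_def observed_r_def seen_r_def)

lemma finite_key_space: "finite (key_space \<phi>)"
  by (simp add: key_space_def finite_dia_args)

text \<open>The left diamonds enter the exponent once, the right ones twice (requested and already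
  seen), and together there are at most \<open>flength \<phi> - 1\<close> of them. With the
  distances this gives at most three times that exponent of 2.\<close>

lemma card_key_space: "card (key_space \<phi>) \<le> 8 ^ (flength \<phi> - 1)"
proof -
  define l r n where "l = card (dia_args_l \<phi>)" "r = card (dia_args_r \<phi>)" "n = flength \<phi> - 1"
  have le: "l + r \<le> n" using card_dia_args[of \<phi>] by (simp add: l_r_n_def)
  have "card (key_space \<phi>) = 2 ^ n * (2 ^ l * (2 ^ r * 2 ^ r))"
    by (simp add: key_space_def l_r_n_def card_cartesian_product card_Pow finite_dia_args)
  also have "\<dots> = 2 ^ (n + (l + (r + r)))" by (simp add: power_add)
  also have "\<dots> \<le> 2 ^ (3 * n)" using le by (intro power_increasing) auto
  also have "\<dots> = 8 ^ n" by (simp add: power_mult)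
  finally show ?thesis by (simp add: l_r_n_def)
qed

text \<open>The cap is the threshold \<open>(r + 1) * l\<close> of the column reassignment for
  \<open>r = flength \<phi> - 1\<close> and \<open>l = flength \<phi>\<close>. Restriction to
  \<open>key_space\<close> leaves only finitely many such functions.\<close>

definition key_count ::
    "'p mpnl \<Rightarrow> nat \<Rightarrow> (nat \<times> nat \<Rightarrow> 'p mpnl set) \<Rightarrow> nat \<Rightarrow>
       nat \<times> 'p mpnl set \<times> 'p mpnl set \<times> 'p mpnl set \<Rightarrow> nat" where
  "key_count \<phi> N \<L> y = (\<lambda>\<kappa>\<in>key_space \<phi>.
     min ((flength \<phi>)\<^sup>2) (card {x. x \<le> y \<and> column_key \<phi> N \<L> y x = \<kappa>}))"

section \<open>Cutting out the rows between two rows with equal counts\<close>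

lemma ex_small_witness_set:
  assumes "finite F"
  shows "\<exists>W. finite W \<and> card W \<le> card F \<and> W \<subseteq> {x. P x} \<and>
    (\<forall>\<psi>\<in>F. \<forall>x. P x \<and> \<psi> \<in> S x \<longrightarrow> (\<exists>w\<in>W. \<psi> \<in> S w))"
proof -
  define F' where "F' = {\<psi> \<in> F. \<exists>x. P x \<and> \<psi> \<in> S x}"
  have "\<forall>\<psi>\<in>F'. \<exists>x. P x \<and> \<psi> \<in> S x" by (simp add: F'_def)
  then obtain w where w: "\<And>\<psi>. \<psi> \<in> F' \<Longrightarrow> P (w \<psi>) \<and> \<psi> \<in> S (w \<psi>)" by metis
  have F': "finite F'" "card F' \<le> card F" using assms by (auto simp: F'_def intro: card_mono)
  have "card (w ` F') \<le> card F" using card_image_le[OF F'(1)] F'(2) le_trans by blast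
  moreover have "\<forall>\<psi>\<in>F. \<forall>x. P x \<and> \<psi> \<in> S x \<longrightarrow> (\<exists>v\<in>w ` F'. \<psi> \<in> S v)"
    using w by (auto simp: F'_def)
  ultimately show ?thesis using w F'(1) by (intro exI[of _ "w ` F'"]) auto
qed

text \<open>Columns are reassigned within each key class separately. The demand of a row splits
  along the classes, each part being no larger than \<open>W y\<close>; the maps are glued by
  letting the key of \<open>x\<close> at \<open>y1\<close> select the class.\<close>

lemma ex_row_dependent_reassignment:
  fixes N :: nat
  assumes counts: "key_count \<phi> N \<L> y1 = key_count \<phi> N \<L> y2"
    and C: "\<And>b. finite (C b) \<and> card (C b) < flength \<phi>"
    and W: "\<And>y. W y \<subseteq> {..y2}" "\<And>y. card (W y) \<le> flength \<phi>"
  shows "\<exists>g :: nat \<Rightarrow> nat \<Rightarrow> nat.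
    (\<forall>y x. x \<le> y1 \<longrightarrow> g y x \<le> y2 \<and> column_key \<phi> N \<L> y2 (g y x) = column_key \<phi> N \<L> y1 x) \<and>
    (\<forall>y. \<forall>v\<in>W y. \<exists>x\<le>y1. g y x = v) \<and>
    (\<forall>x\<le>y1. \<exists>b\<le>y2. column_key \<phi> N \<L> y2 b = column_key \<phi> N \<L> y1 x \<and> (\<forall>y\<in>C b. g y x = b))"
proof -
  let ?k1 = "column_key \<phi> N \<L> y1" and ?k2 = "column_key \<phi> N \<L> y2"
  define A where "A \<kappa> = {x. x \<le> y1 \<and> ?k1 x = \<kappa>}" for \<kappa>
  define B where "B \<kappa> = {x. x \<le> y2 \<and> ?k2 x = \<kappa>}" for \<kappa>
  have n: "flength \<phi> > 0" by (cases \<phi>) auto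
  have "\<exists>g. (\<forall>y. \<forall>x\<in>A \<kappa>. g y x \<in> B \<kappa>) \<and> (\<forall>y. \<forall>v\<in>W y \<inter> B \<kappa>. \<exists>x\<in>A \<kappa>. g y x = v) \<and>
             (\<forall>x\<in>A \<kappa>. \<exists>b\<in>B \<kappa>. \<forall>y\<in>C b. g y x = b)" if "\<kappa> \<in> key_space \<phi>" for \<kappa>
  proof (rule ex_column_reassignment[where r = "flength \<phi> - 1" and l = "flength \<phi>"])
    show "finite (A \<kappa>)" "finite (B \<kappa>)" by (auto simp: A_def B_def)
    show "min ((flength \<phi> - 1 + 1) * flength \<phi>) (card (A \<kappa>)) =
          min ((flength \<phi> - 1 + 1) * flength \<phi>) (card (B \<kappa>))"
      using fun_cong[OF counts, of \<kappa>] that n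
      by (simp add: key_count_def A_def B_def power2_eq_square)
    show "finite (C b) \<and> card (C b) \<le> flength \<phi> - 1" for b using C[of b] by auto
    show "card (W y \<inter> B \<kappa>) \<le> flength \<phi>" for y
      using W(2)[of y] card_mono[of "W y" "W y \<inter> B \<kappa>"] finite_subset[OF W(1)[of y]] by auto
  qed (use n in auto)
  then obtain G where G: "\<And>\<kappa>. \<kappa> \<in> key_space \<phi> \<Longrightarrow>
      (\<forall>y. \<forall>x\<in>A \<kappa>. G \<kappa> y x \<in> B \<kappa>) \<and> (\<forall>y. \<forall>v\<in>W y \<inter> B \<kappa>. \<exists>x\<in>A \<kappa>. G \<kappa> y x = v) \<and>
      (\<forall>x\<in>A \<kappa>. \<exists>b\<in>B \<kappa>. \<forall>y\<in>C b. G \<kappa> y x = b)"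
    by metis
  define g where "g y x = G (?k1 x) y x" for y x
  show ?thesis
  proof (intro exI[of _ g] conjI allI ballI impI)
    fix x y assume "x \<le> y1"
    then show "g y x \<le> y2" "?k2 (g y x) = ?k1 x"
      using G[OF column_key_in_key_space, of N \<L> y1 x] by (auto simp: g_def A_def B_def)
  next
    fix y v assume v: "v \<in> W y"
    then have "v \<in> W y \<inter> B (?k2 v)" using W(1) by (auto simp: B_def)
    then obtain x where "x \<in> A (?k2 v)" "G (?k2 v) y x = v"
      using G[OF column_key_in_key_space] by blast
    then show "\<exists>x\<le>y1. g y x = v" by (auto simp: A_def g_def)
  next
    fix x assume "x \<le> y1"
    then show "\<exists>b\<le>y2. ?k2 b = ?k1 x \<and> (\<forall>y\<in>C b. g y x = b)"
      using G[OF column_key_in_key_space, of N \<L> y1 x] by (auto simp: g_def A_def B_def)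
  qed
qed

text \<open>The \<open>s\<close> rows after \<open>y1\<close> up to \<open>y2\<close> disappear, and
  equal keys keep requests and observations in step across the cut. The last assumption says that
  the row of the point featuring the formula is not among the removed ones.\<close>

lemma contraction:
  assumes e: "exact_structure \<phi> N \<L>"
    and y12: "y1 < y2" "y2 < N"
    and counts: "key_count \<phi> N \<L> y1 = key_count \<phi> N \<L> y2"
    and feat: "x0 \<le> y0" "y0 < N" "canon \<phi> \<in> \<L> (x0, y0)" "y0 \<le> y1 \<longleftrightarrow> y0 \<le> y2"
  obtains N' \<L>' x y where "N' < N" "exact_structure \<phi> N' \<L>'" "x \<le> y" "y < N'" "canon \<phi> \<in> \<L>' (x, y)"
proof -
  define s where "s = y2 - y1"
  have s: "s > 0" "y2 = y1 + s" using y12 by (auto simp: s_def)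
  have n: "card (dia_args_r \<phi>) < flength \<phi>" "card (dia_args_l \<phi>) < flength \<phi>"
    using card_dia_args[of \<phi>] by auto

  \<comment> \<open>For each column, one row above the cut per right formula occurring there. If
    \<open>g\<close> returns \<open>b\<close> in all rows of \<open>C b\<close>, every pending right
    request of \<open>b\<close> is met.\<close>
  have "\<exists>C. finite C \<and> card C \<le> card (dia_args_r \<phi>) \<and> C \<subseteq> {y. y2 < y \<and> y < N} \<and>
      (\<forall>\<psi>\<in>dia_args_r \<phi>. \<forall>y. (y2 < y \<and> y < N) \<and> \<psi> \<in> \<L> (b, y) \<longrightarrow> (\<exists>w\<in>C. \<psi> \<in> \<L> (b, w)))" for b
    using ex_small_witness_set[OF finite_dia_args(2), of \<phi> "\<lambda>y. y2 < y \<and> y < N" "\<lambda>y. \<L> (b, y)"]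
    by simp
  then obtain C where C: "\<And>b. finite (C b)" "\<And>b. card (C b) \<le> card (dia_args_r \<phi>)"
      "\<And>b. C b \<subseteq> {y. y2 < y \<and> y < N}"
      "\<And>b \<psi> y. \<psi> \<in> dia_args_r \<phi> \<Longrightarrow> y2 < y \<Longrightarrow> y < N \<Longrightarrow> \<psi> \<in> \<L> (b, y) \<Longrightarrow> \<exists>w\<in>C b. \<psi> \<in> \<L> (b, w)"
    by metis

  \<comment> \<open>\<open>canon \<phi>\<close> is treated like a left observation, so that an
    occurrence in a column up to \<open>y2\<close> is also carried over by \<open>g\<close>. The
    strict bound on \<open>dia_args_l\<close> leaves room for it.\<close>
  let ?F = "insert (canon \<phi>) (dia_args_l \<phi>)"
  have F: "finite ?F" "card ?F \<le> flength \<phi>"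
    using n(2) by (auto simp: finite_dia_args card_insert_if)
  have "\<exists>W. finite W \<and> card W \<le> card ?F \<and> W \<subseteq> {x. x \<le> y2} \<and>
      (\<forall>\<psi>\<in>?F. \<forall>x. x \<le> y2 \<and> \<psi> \<in> \<L> (x, y) \<longrightarrow> (\<exists>w\<in>W. \<psi> \<in> \<L> (w, y)))" for y
    by (rule ex_small_witness_set[OF F(1), of "\<lambda>x. x \<le> y2" "\<lambda>x. \<L> (x, y)"])
  then obtain W where W: "\<And>y. card (W y) \<le> card ?F" "\<And>y. W y \<subseteq> {x. x \<le> y2}"
      "\<And>y \<psi> x. \<psi> \<in> ?F \<Longrightarrow> x \<le> y2 \<Longrightarrow> \<psi> \<in> \<L> (x, y) \<Longrightarrow> \<exists>w\<in>W y. \<psi> \<in> \<L> (w, y)"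
    by metis

  have C': "finite (C b) \<and> card (C b) < flength \<phi>" for b using C(1,2)[of b] n(1) by simp
  have W': "W y \<subseteq> {..y2}" "card (W y) \<le> flength \<phi>" for y
    using W(1,2)[of y] F(2) by auto
  obtain g :: "nat \<Rightarrow> nat \<Rightarrow> nat" where
    g: "\<And>y x. x \<le> y1 \<Longrightarrow> g y x \<le> y2 \<and> column_key \<phi> N \<L> y2 (g y x) = column_key \<phi> N \<L> y1 x"
    and gW: "\<And>y v. v \<in> W y \<Longrightarrow> \<exists>x\<le>y1. g y x = v"
    and gC: "\<And>x. x \<le> y1 \<Longrightarrow>
      \<exists>b\<le>y2. column_key \<phi> N \<L> y2 b = column_key \<phi> N \<L> y1 x \<and> (\<forall>y\<in>C b. g y x = b)"
    using ex_row_dependent_reassignment[where C = C and W = W, OF counts C' W'] by blast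

  define N' where "N' = N - s"
  \<comment> \<open>Rows above \<open>y1\<close> are old rows shifted down by \<open>s\<close>. In
    them, columns above \<open>y1\<close> are shifted as well, while the old columns read their
    labels through \<open>g\<close>.\<close>
  define \<L>' where "\<L>' = (\<lambda>(x, y). if y \<le> y1 then \<L> (x, y) else
      \<L> (if x \<le> y1 then g (y + s) x else x + s, y + s))"
  have low: "\<L>' (x, y) = \<L> (x, y)" if "y \<le> y1" for x y
    using that by (simp add: \<L>'_def)
  have mid: "\<L>' (x, y) = \<L> (g (y + s) x, y + s)" if "x \<le> y1" "y1 < y" for x y
    using that by (simp add: \<L>'_def)
  have high: "\<L>' (x, y) = \<L> (x + s, y + s)" if "y1 < x" "x \<le> y" for x y
    using that by (simp add: \<L>'_def)

  have l_low: "observed_l \<phi> \<L>' x = observed_l \<phi> \<L> x" if "x \<le> y1" for x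
    using that by (simp add: observed_l_def low)

  have W_new: "\<exists>x\<le>y1. \<psi> \<in> \<L>' (x, y)" if a: "\<psi> \<in> ?F" "x \<le> y2" "y1 < y" "\<psi> \<in> \<L> (x, y + s)"
    for \<psi> x y
  proof -
    obtain w where "w \<in> W (y + s)" "\<psi> \<in> \<L> (w, y + s)" using W(3)[OF a(1,2,4)] by blast
    moreover then obtain x' where "x' \<le> y1" "g (y + s) x' = w" using gW by blast
    ultimately show ?thesis using mid a(3) by metis
  qed

  have l_high: "observed_l \<phi> \<L>' x = observed_l \<phi> \<L> (x + s)" if x: "y1 < x" for x
  proof (intro set_eqI iffI)
    fix \<psi> assume "\<psi> \<in> observed_l \<phi> \<L>' x"
    then obtain x' where \<psi>: "\<psi> \<in> dia_args_l \<phi>" and x': "x' \<le> x" "\<psi> \<in> \<L>' (x', x)"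
      by (auto simp: observed_l_def)
    have "\<exists>z\<le>x + s. \<psi> \<in> \<L> (z, x + s)"
    proof (cases "x' \<le> y1")
      case True
      show ?thesis
        using x' mid[OF True x] g[OF True, of "x + s"] x s
        by (intro exI[of _ "g (x + s) x'"]) auto
    next
      case False
      then show ?thesis using x' high[of x' x] by (intro exI[of _ "x' + s"]) auto
    qed
    then show "\<psi> \<in> observed_l \<phi> \<L> (x + s)" using \<psi> by (auto simp: observed_l_def)
  next
    fix \<psi> assume "\<psi> \<in> observed_l \<phi> \<L> (x + s)"
    then obtain z where \<psi>: "\<psi> \<in> dia_args_l \<phi>" and z: "z \<le> x + s" "\<psi> \<in> \<L> (z, x + s)"
      by (auto simp: observed_l_def)
    have "\<exists>x'\<le>x. \<psi> \<in> \<L>' (x', x)"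
    proof (cases "z \<le> y2")
      case True
      then obtain x' where "x' \<le> y1" "\<psi> \<in> \<L>' (x', x)" using W_new[of \<psi> z x] \<psi> z x by blast
      then show ?thesis using x by (intro exI[of _ x']) auto
    next
      case False
      then show ?thesis using z s high[of "z - s" x] by (intro exI[of _ "z - s"]) auto
    qed
    then show "\<psi> \<in> observed_l \<phi> \<L>' x" using \<psi> by (auto simp: observed_l_def)
  qed

  have r_high: "observed_r \<phi> N' \<L>' y = observed_r \<phi> N \<L> (y + s)" if y: "y1 < y" for y
  proof (intro set_eqI iffI)
    fix \<psi> assume "\<psi> \<in> observed_r \<phi> N' \<L>' y"
    then obtain z where \<psi>: "\<psi> \<in> dia_args_r \<phi>" and z: "y \<le> z" "z < N'" "\<psi> \<in> \<L>' (y, z)"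
      by (auto simp: observed_r_def)
    then have "y + s \<le> z + s \<and> z + s < N \<and> \<psi> \<in> \<L> (y + s, z + s)"
      using high[OF y z(1)] by (auto simp: N'_def)
    then show "\<psi> \<in> observed_r \<phi> N \<L> (y + s)" using \<psi> unfolding observed_r_def by blast
  next
    fix \<psi> assume "\<psi> \<in> observed_r \<phi> N \<L> (y + s)"
    then obtain z where \<psi>: "\<psi> \<in> dia_args_r \<phi>" and z: "y + s \<le> z" "z < N" "\<psi> \<in> \<L> (y + s, z)"
      by (auto simp: observed_r_def)
    then have "y \<le> z - s \<and> z - s < N' \<and> \<psi> \<in> \<L>' (y, z - s)"
      using high[OF y, of "z - s"] by (auto simp: N'_def)
    then show "\<psi> \<in> observed_r \<phi> N' \<L>' y" using \<psi> unfolding observed_r_def by blast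
  qed

  have r_low: "observed_r \<phi> N' \<L>' y = observed_r \<phi> N \<L> y" if y: "y \<le> y1" for y
  proof (intro set_eqI iffI)
    fix \<psi> assume "\<psi> \<in> observed_r \<phi> N' \<L>' y"
    then obtain z where \<psi>: "\<psi> \<in> dia_args_r \<phi>" and z: "y \<le> z" "z < N'" "\<psi> \<in> \<L>' (y, z)"
      by (auto simp: observed_r_def)
    show "\<psi> \<in> observed_r \<phi> N \<L> y"
    proof (cases "z \<le> y1")
      case True
      then show ?thesis using \<psi> z low y12 by (auto simp: observed_r_def)
    next
      case False
      then have "\<psi> \<in> \<L> (g (z + s) y, z + s)" using z mid[OF y] by simp
      moreover have "g (z + s) y \<le> z + s" "z + s < N"
        using g[OF y, of "z + s"] False z s by (auto simp: N'_def)
      \<comment> \<open>The column behind \<open>y\<close> may change from row to row, but each one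
        has the right requests of \<open>y\<close> as part of its key.\<close>
      ultimately have "\<psi> \<in> observed_r \<phi> N \<L> (g (z + s) y)"
        using \<psi> unfolding observed_r_def by blast
      then show ?thesis using g[OF y, of "z + s"] by (simp add: column_key_def)
    qed
  next
    fix \<psi> assume \<psi>: "\<psi> \<in> observed_r \<phi> N \<L> y"
    then have \<psi>D: "\<psi> \<in> dia_args_r \<phi>" by (simp add: observed_r_def)
    have "\<exists>z\<ge>y. z < N' \<and> \<psi> \<in> \<L>' (y, z)"
    proof (cases "\<psi> \<in> seen_r \<phi> \<L> y1 y")
      case True
      then obtain z where "y \<le> z" "z \<le> y1" "\<psi> \<in> \<L> (y, z)" by (auto simp: seen_r_def)
      then show ?thesis using low y12 by (intro exI[of _ z]) (auto simp: N'_def s_def)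
    next
      case False
      obtain b where b: "b \<le> y2" "column_key \<phi> N \<L> y2 b = column_key \<phi> N \<L> y1 y"
          "\<And>z. z \<in> C b \<Longrightarrow> g z y = b"
        using gC[OF y] by blast
      \<comment> \<open>Equal keys mean equal pending requests: what \<open>y\<close> still lacks at
        row \<open>y1\<close>, column \<open>b\<close> lacks at row \<open>y2\<close>, so it occurs
        in column \<open>b\<close> strictly above the cut.\<close>
      have "\<psi> \<in> observed_r \<phi> N \<L> b" "\<psi> \<notin> seen_r \<phi> \<L> y2 b"
        using b(2) \<psi> False by (auto simp: column_key_def)
      then obtain z where "b \<le> z" "z < N" "\<psi> \<in> \<L> (b, z)" "\<not> z \<le> y2"
        by (auto simp: observed_r_def seen_r_def)
      then obtain w where w: "w \<in> C b" "\<psi> \<in> \<L> (b, w)" using C(4)[OF \<psi>D, of z b] by auto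
      then have "y2 < w" "w < N" using C(3) by auto
      then have "\<L>' (y, w - s) = \<L> (b, w)"
        using mid[OF y, of "w - s"] b(3)[OF w(1)] s by auto
      then show ?thesis
        using w \<open>y2 < w\<close> \<open>w < N\<close> y s by (intro exI[of _ "w - s"]) (auto simp: N'_def)
    qed
    then show "\<psi> \<in> observed_r \<phi> N' \<L>' y" using \<psi>D by (auto simp: observed_r_def)
  qed

  have "exact_structure \<phi> N' \<L>'"
    unfolding exact_structure_def
  proof (intro allI impI)
    fix x y assume xy: "x \<le> y \<and> y < N'"
    consider "y \<le> y1" | "x \<le> y1" "y1 < y" | "y1 < x" by linarith
    then show "is_atom \<phi> (\<L>' (x, y)) \<and> (\<forall>k. Len k \<in> \<L>' (x, y) \<longrightarrow> y - x < k) \<and>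
      Req_r (\<L>' (x, y)) = observed_r \<phi> N' \<L>' y \<and> Req_l (\<L>' (x, y)) = observed_l \<phi> \<L>' x"
    proof cases
      case 1
      then show ?thesis
        using xy exact_structureD[OF e, of x y] y12 low r_low l_low by simp
    next
      case 2
      let ?x = "g (y + s) x"
      have gx: "?x \<le> y2" "column_key \<phi> N \<L> y2 ?x = column_key \<phi> N \<L> y1 x"
        using g[OF 2(1)] by auto
      have pt: "?x \<le> y + s" "y + s < N" using gx(1) 2 s xy by (auto simp: N'_def)
      note D = exact_structureD[OF e pt]
      have "y - x < k" if k: "Len k \<in> \<L> (?x, y + s)" for k
      proof -
        \<comment> \<open>If the old length is below \<open>k\<close>, then \<open>y2 - ?x\<close>
          is below \<open>K\<close>, so the truncated distances are exact and the new length equals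
          the old one.\<close>
        define K :: nat where "K = 2 ^ (flength \<phi> - 1) - 1"
        have "k \<le> K"
        proof -
          have "\<L> (?x, y + s) \<subseteq> Cl \<phi>" using D(1) unfolding is_atom_def by blast
          then have "k < 2 ^ (flength \<phi> - 1)" using k Len_in_Cl_less by blast
          then show ?thesis by (simp add: K_def)
        qed
        moreover have "min K (y2 - ?x) = min K (y1 - x)"
          using gx(2) by (simp add: column_key_def K_def)
        moreover have "(y - y1) + (y2 - ?x) = y + s - ?x" "(y - y1) + (y1 - x) = y - x"
          using 2 s gx(1) by simp_all
        ultimately show ?thesis using D(2)[OF k] by (auto simp: min_def split: if_splits)
      qed
      then show ?thesis
        using D 2 mid r_high l_low gx(2) by (simp add: column_key_def)
    next
      case 3
      have "x + s \<le> y + s" "y + s < N" using xy by (auto simp: N'_def)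
      then show ?thesis
        using xy 3 exact_structureD[OF e, of "x + s" "y + s"] high r_high l_high by simp
    qed
  qed
  moreover have "\<exists>x y. x \<le> y \<and> y < N' \<and> canon \<phi> \<in> \<L>' (x, y)"
  proof (cases "y0 \<le> y1")
    case True
    then show ?thesis using feat low y12 by (intro exI[of _ x0] exI[of _ y0]) (auto simp: N'_def s_def)
  next
    case False
    then have y0: "y2 < y0" "y1 < y0 - s" "y0 - s < N'" "y0 - s + s = y0"
      using feat s by (auto simp: N'_def)
    show ?thesis
    proof (cases "x0 \<le> y2")
      case True
      then obtain x where "x \<le> y1" "canon \<phi> \<in> \<L>' (x, y0 - s)"
        using W_new[of "canon \<phi>" x0 "y0 - s"] y0 feat by auto
      then show ?thesis using y0 by (intro exI[of _ x] exI[of _ "y0 - s"]) auto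
    next
      case False
      then show ?thesis using high[of "x0 - s" "y0 - s"] feat s y0
        by (intro exI[of _ "x0 - s"] exI[of _ "y0 - s"]) auto
    qed
  qed
  moreover have "N' < N" using s y12 by (simp add: N'_def)
  ultimately show ?thesis using that by blast
qed

section \<open>The bound\<close>

text \<open>Pigeonhole on pairs of a bit and a counting function. The bit \<open>y0 \<le> y\<close>
  costs the factor 2 and keeps row \<open>y0\<close> out of the cut.\<close>

lemma ex_equal_rows:
  assumes "2 * ((flength \<phi>)\<^sup>2 + 1) ^ card (key_space \<phi>) < N"
  obtains y1 y2 where "y1 < y2" "y2 < N" "key_count \<phi> N \<L> y1 = key_count \<phi> N \<L> y2"
    "y0 \<le> y1 \<longleftrightarrow> y0 \<le> y2"
proof -
  define V where "V y = (y0 \<le> y, key_count \<phi> N \<L> y)" for y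
  let ?V = "(UNIV :: bool set) \<times> (key_space \<phi> \<rightarrow>\<^sub>E {..(flength \<phi>)\<^sup>2})"
  have "V ` {..<N} \<subseteq> ?V" by (auto simp: V_def key_count_def)
  moreover have "finite ?V" by (simp add: finite_PiE finite_key_space)
  ultimately have "card (V ` {..<N}) \<le> card ?V" by (meson card_mono)
  also have "\<dots> = 2 * ((flength \<phi>)\<^sup>2 + 1) ^ card (key_space \<phi>)"
    by (simp add: card_cartesian_product card_PiE finite_key_space)
  finally have "\<not> inj_on V {..<N}" using assms by (intro pigeonhole) simp
  then obtain a b where ab: "a < N" "b < N" "V a = V b" "a \<noteq> b" by (auto simp: inj_on_def)
  show ?thesis
  proof (cases "a < b")
    case True
    then show ?thesis using that[of a b] ab by (simp add: V_def)
  next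
    case False
    then show ?thesis using that[of b a] ab by (simp add: V_def)
  qed
qed

text \<open>The passage from \<open>8 ^ (n - 1)\<close> to \<open>2 ^ (3 * n)\<close> leaves a
  factor 8 in the exponent. One doubling absorbs the leading 2, as
  \<open>2 \<le> n\<^sup>2 + 1\<close>; another pays for replacing \<open>n\<^sup>2 + 1\<close> by
  the square of the base.\<close>

lemma counting_bound:
  fixes n E :: nat
  assumes n: "n > 0" and E: "E \<le> 8 ^ (n - 1)" "E > 0"
  shows "real (2 * (n\<^sup>2 + 1) ^ E) \<le> ((real n)\<^sup>2 / 4 + real n / 2 + 1) ^ (2 ^ (3 * n))"
proof -
  define c where "c = (real n)\<^sup>2 / 4 + real n / 2 + 1"
  have c: "c \<ge> 1" by (simp add: c_def)
  have "c\<^sup>2 = (real n ^ 4) / 16 + (real n)^3 / 4 + 3 / 4 * (real n)\<^sup>2 + real n + 1"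
    by (simp add: c_def power2_eq_square power3_eq_cube power4_eq_xxxx algebra_simps)
  moreover have "(real n)\<^sup>2 / 4 \<le> (real n)^3 / 4"
    using n by (intro divide_right_mono power_increasing) auto
  moreover have "0 \<le> real n ^ 4 / 16" by simp
  ultimately have base: "(real n)\<^sup>2 + 1 \<le> c\<^sup>2" by linarith
  have "(8::nat) ^ n = 8 * 8 ^ (n - 1)" using n by (cases n) auto
  then have exponent: "4 * E \<le> 2 ^ (3 * n)" using E by (simp add: power_mult)
  have "real (2 * (n\<^sup>2 + 1) ^ E) \<le> ((real n)\<^sup>2 + 1) * ((real n)\<^sup>2 + 1) ^ E"
    using n by (simp add: add.commute mult_right_mono)
  also have "\<dots> = ((real n)\<^sup>2 + 1) ^ (E + 1)" by simp
  also have "\<dots> \<le> ((real n)\<^sup>2 + 1) ^ (2 * E)" using E by (intro power_increasing) auto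
  also have "\<dots> \<le> (c\<^sup>2) ^ (2 * E)" using base by (intro power_mono) auto
  also have "\<dots> = c ^ (4 * E)" by (simp flip: power_mult)
  also have "\<dots> \<le> c ^ (2 ^ (3 * n))" using exponent c by (intro power_increasing) auto
  finally show ?thesis by (simp add: c_def)
qed

theorem theorem1:
  fixes \<phi> :: "'p mpnl"
  assumes "\<exists>D \<L>. finite_prefix D \<and> compass_structure \<phi> D \<L> \<and> fulfilling D \<L> \<and> features D \<L> \<phi>"
  shows "\<exists>D' \<L>'. finite_prefix D' \<and> compass_structure \<phi> D' \<L>' \<and> fulfilling D' \<L>' \<and> features D' \<L>' \<phi> \<and>
           real (card D') \<le>
             ((real (flength \<phi>))\<^sup>2 / 4 + real (flength \<phi>) / 2 + 1) ^ (2 ^ (3 * flength \<phi>))"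
proof -
  \<comment> \<open>With \<open>N\<close> minimal over all labellings, a single contraction already
    gives a contradiction.\<close>
  define P where "P N \<longleftrightarrow> (\<exists>\<L> x y. exact_structure \<phi> N \<L> \<and> x \<le> y \<and> y < N \<and> canon \<phi> \<in> \<L> (x, y))" for N
  have "\<exists>N. P N"
    using assms exact_structure_if_fulfilling
    unfolding P_def finite_prefix_def features_def by (metis in_points_lessThan surj_pair)
  then obtain N where N: "P N" and minimal: "\<And>N'. N' < N \<Longrightarrow> \<not> P N'"
    using exists_least_iff[of P] by blast
  obtain \<L> x y where e: "exact_structure \<phi> N \<L>" and xy: "x \<le> y" "y < N" "canon \<phi> \<in> \<L> (x, y)"
    using N by (auto simp: P_def)
  have "N \<le> 2 * ((flength \<phi>)\<^sup>2 + 1) ^ card (key_space \<phi>)"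
  proof (rule ccontr)
    assume "\<not> ?thesis"
    then have "2 * ((flength \<phi>)\<^sup>2 + 1) ^ card (key_space \<phi>) < N" by simp
    then obtain y1 y2 where rows: "y1 < y2" "y2 < N"
        "key_count \<phi> N \<L> y1 = key_count \<phi> N \<L> y2" "y \<le> y1 \<longleftrightarrow> y \<le> y2"
      by (rule ex_equal_rows)
    obtain N' where "N' < N" "P N'"
      using contraction[OF e rows(1-3) xy rows(4)] unfolding P_def by metis
    then show False using minimal by blast
  qed
  then have "real N \<le> real (2 * ((flength \<phi>)\<^sup>2 + 1) ^ card (key_space \<phi>))"
    by (rule of_nat_mono)
  also have "\<dots> \<le> ((real (flength \<phi>))\<^sup>2 / 4 + real (flength \<phi>) / 2 + 1) ^ (2 ^ (3 * flength \<phi>))"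
  proof (rule counting_bound)
    show "flength \<phi> > 0" by (cases \<phi>) auto
    show "card (key_space \<phi>) > 0"
      using finite_key_space column_key_in_key_space[of \<phi>] by (metis card_gt_0_iff empty_iff)
  qed (rule card_key_space)
  finally have "real (card {..<N}) \<le> \<dots>" by simp
  moreover have "finite_prefix {..<N}" by (auto simp: finite_prefix_def)
  moreover have "features {..<N} \<L> \<phi>"
    using xy by (auto simp: features_def in_points_lessThan intro!: bexI[of _ "(x, y)"])
  ultimately show ?thesis using fulfilling_if_exact_structure[OF e] by blast
qed

end
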